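(* Let $X$ be an infinite $\mathsf{T}_1$ topological space with the Menger property $\mathsf{S}_{fin}(\mathcal{O},\mathcal{O})$. The following are equivalent: (1) $X$ is almost Rothberger, i.e. $X$ has the property $\mathsf{S}_1(\mathcal{O},\overline{\mathcal{O}})$. (2) Player ONE has no winning strategy in the game $\mathsf{G}_1^{\omega}(\mathcal{O},\overline{\mathcal{O}})$ on $X$.
   Context: For a topological space $X$: $\mathcal{O}$ is the collection of all open covers of $X$; $\overline{\mathcal{O}}$ is the collection of families $\mathcal{U}$ of open subsets of $X$ for which $\{\overline{U}:U\in\mathcal{U}\}$ covers $X$, where $\overline{U}$ is the closure of $U$. Let $\mathcal{A},\mathcal{B}$ be collections of families of sets. $\mathsf{S}_1(\mathcal{A},\mathcal{B})$ is the statement: for each sequence $(A_n:n\in\mathbb{N})$ of elements of $\mathcal{A}$ there is a sequence $(B_n:n\in\mathbb{N})$ with $B_n\in A_n$ for each $n$ and $\{B_n:n\in\mathbb{N}\}\in\mathcal{B}$. $\mathsf{S}_{fin}(\mathcal{A},\mathcal{B})$ is the statement: for each sequence $(A_n:n\in\mathbb{N})$ of elements of $\mathcal{A}$ there is a sequence $(B_n:n\in\mathbb{N})$ such that each $B_n$ is a finite subset of $A_n$ and $\bigcup\{B_n:n\in\mathbb{N}\}\in\mathcal{B}$. A space is Menger if it satisfies $\mathsf{S}_{fin}(\mathcal{O},\mathcal{O})$. The game $\mathsf{G}_1^{\omega}(\mathcal{A},\mathcal{B})$: players ONE and TWO play an inning for each $n\in\omega$. In inning $n$ ONE first selects $O_n\in\mathcal{A}$,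 then TWO responds with $T_n\in O_n$. TWO wins the play $O_0,T_0,\dots,O_n,T_n,\dots$ if $\{T_n:n\in\omega\}\in\mathcal{B}$; otherwise ONE wins. A strategy of a player prescribes that player's next move as a function of the opponent's moves so far; it is winning if every play in which the player follows it is won by that player. *)

theory Defs
  imports "HOL-Analysis.Analysis"
begin

definition open_covers :: "'a topology \<Rightarrow> 'a set set set" where
  "open_covers X = {\<U>. (\<forall>U\<in>\<U>. openin X U) \<and> \<Union>\<U> = topspace X}"

definition almost_open_covers :: "'a topology \<Rightarrow> 'a set set set" where
  "almost_open_covers X =
     {\<U>. (\<forall>U\<in>\<U>. openin X U) \<and> (\<Union>U\<in>\<U>. X closure_of U) = topspace X}"

definition S1 :: "'b set set \<Rightarrow> 'b set set \<Rightarrow> bool" where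
  "S1 \<A> \<B> \<longleftrightarrow>
     (\<forall>A :: nat \<Rightarrow> 'b set. (\<forall>n. A n \<in> \<A>) \<longrightarrow>
        (\<exists>B :: nat \<Rightarrow> 'b. (\<forall>n. B n \<in> A n) \<and> {B n |n. True} \<in> \<B>))"

definition Sfin :: "'b set set \<Rightarrow> 'b set set \<Rightarrow> bool" where
  "Sfin \<A> \<B> \<longleftrightarrow>
     (\<forall>A :: nat \<Rightarrow> 'b set. (\<forall>n. A n \<in> \<A>) \<longrightarrow>
        (\<exists>B :: nat \<Rightarrow> 'b set. (\<forall>n. finite (B n) \<and> B n \<subseteq> A n) \<and> (\<Union>n. B n) \<in> \<B>))"

definition Menger_space :: "'a topology \<Rightarrow> bool" where
  "Menger_space X \<longleftrightarrow> Sfin (open_covers X) (open_covers X)"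

definition almost_Rothberger_space :: "'a topology \<Rightarrow> bool" where
  "almost_Rothberger_space X \<longleftrightarrow> S1 (open_covers X) (almost_open_covers X)"

text \<open>
  The selection game of length \<open>\<omega>\<close>, in which ONE plays \<open>C 0, C 1, \<dots>\<close> and TWO plays \<open>T 0, T 1, \<dots>\<close>.
  A strategy of ONE maps the list of TWO's previous moves (oldest first) to ONE's next move; it has
  to prescribe a legal move after every legal sequence of responses of TWO, and its values on
  other lists are irrelevant.
\<close>

definition G1_play :: "'b set set \<Rightarrow> (nat \<Rightarrow> 'b set) \<Rightarrow> (nat \<Rightarrow> 'b) \<Rightarrow> bool" where
  "G1_play \<A> C T \<longleftrightarrow> (\<forall>n. C n \<in> \<A> \<and> T n \<in> C n)"

definition G1_TWO_wins :: "'b set set \<Rightarrow> (nat \<Rightarrow> 'b) \<Rightarrow> bool" where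
  "G1_TWO_wins \<B> T \<longleftrightarrow> {T n |n. True} \<in> \<B>"

definition G1_strategy_ONE :: "'b set set \<Rightarrow> ('b list \<Rightarrow> 'b set) \<Rightarrow> bool" where
  "G1_strategy_ONE \<A> \<sigma> \<longleftrightarrow>
     (\<forall>ts. (\<forall>i<length ts. ts ! i \<in> \<sigma> (take i ts)) \<longrightarrow> \<sigma> ts \<in> \<A>)"

definition G1_follows_ONE ::
    "('b list \<Rightarrow> 'b set) \<Rightarrow> (nat \<Rightarrow> 'b set) \<Rightarrow> (nat \<Rightarrow> 'b) \<Rightarrow> bool" where
  "G1_follows_ONE \<sigma> C T \<longleftrightarrow> (\<forall>n. C n = \<sigma> (map T [0..<n]))"

definition G1_winning_strategy_ONE ::
    "'b set set \<Rightarrow> 'b set set \<Rightarrow> ('b list \<Rightarrow> 'b set) \<Rightarrow> bool" where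
  "G1_winning_strategy_ONE \<A> \<B> \<sigma> \<longleftrightarrow>
     G1_strategy_ONE \<A> \<sigma> \<and>
     (\<forall>C T. G1_play \<A> C T \<and> G1_follows_ONE \<sigma> C T \<longrightarrow> \<not> G1_TWO_wins \<B> T)"

end

theory Submission
  imports Defs
begin

text \<open>
  For the nontrivial direction, a strategy of ONE is pruned, by the Lindelof property, to a tree
  of countable covers indexed by finite sequences of natural numbers (Pawlikowski's method). The
  Menger property yields a sequence \<open>g\<close> such that each point lies, for infinitely many \<open>n\<close>, in
  the intersection over all positions \<open>t\<close> of length \<open>n\<close> below \<open>g\<close> of the union of the first
  \<open>g n\<close> sets available at \<open>t\<close>. Distributing these intersections over the unions, the almost
  Rothberger property selects for each \<open>n\<close> a simultaneous response to all positions of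
  length \<open>n\<close> below \<open>g\<close>, and playing these responses defeats the strategy.
\<close>

section \<open>Consequences of the Menger property\<close>

text \<open>Finitely many members of an increasing sequence lie in a single one, so a finite
  selection can be replaced by one set per cover.\<close>

lemma menger_monotone_covers:
  fixes D :: "nat \<Rightarrow> nat \<Rightarrow> 'a set"
  assumes "Menger_space X"
    and op: "\<And>n m. openin X (D n m)"
    and mono: "\<And>n. mono (D n)"
    and cov: "\<And>n. (\<Union>m. D n m) = topspace X"
  obtains q where "(\<Union>n. D n (q n)) = topspace X"
proof -
  have "range (D n) \<in> open_covers X" for n
    using op cov by (auto simp: open_covers_def)
  then obtain B where B: "\<And>n. finite (B n) \<and> B n \<subseteq> range (D n)"
      and BO: "(\<Union>n. B n) \<in> open_covers X"
    using assms(1) unfolding Menger_space_def Sfin_def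
    by (elim allE[of _ "\<lambda>n. range (D n)"]) auto
  have "\<exists>m. \<Union>(B n) \<subseteq> D n m" for n
  proof -
    obtain M where M: "finite M" "B n = D n ` M"
      using B[of n] finite_subset_image[of "B n" "D n" UNIV] by blast
    \<comment> \<open>Inserting \<open>0\<close> covers the case of an empty selection.\<close>
    have "\<Union>(B n) \<subseteq> D n (Max (insert 0 M))"
    proof (rule Union_least)
      fix A assume "A \<in> B n"
      then obtain m where "m \<in> M" "A = D n m" using M(2) by blast
      then show "A \<subseteq> D n (Max (insert 0 M))" using M(1) by (auto intro!: monoD[OF mono])
    qed
    then show ?thesis ..
  qed
  then obtain q where q: "\<And>n. \<Union>(B n) \<subseteq> D n (q n)" by metis
  have "(\<Union>n. D n (q n)) = topspace X"
  proof
    show "(\<Union>n. D n (q n)) \<subseteq> topspace X"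
      using openin_subset[OF op] by blast
    have "topspace X = \<Union>(\<Union>n. B n)" using BO by (simp add: open_covers_def)
    also have "\<dots> \<subseteq> (\<Union>n. D n (q n))" using q by blast
    finally show "topspace X \<subseteq> (\<Union>n. D n (q n))" .
  qed
  then show thesis ..
qed

lemma menger_countable_subcover:
  assumes "Menger_space X" "\<U> \<in> open_covers X"
  obtains \<V> where "countable \<V>" "\<V> \<subseteq> \<U>" "\<V> \<in> open_covers X"
proof -
  obtain B where "\<And>n::nat. finite (B n) \<and> B n \<subseteq> \<U>" "(\<Union>n. B n) \<in> open_covers X"
    using assms unfolding Menger_space_def Sfin_def
    by (elim allE[of _ "\<lambda>_. \<U>"]) auto
  moreover from this have "countable (\<Union>n. B n)" by (intro countable_UN) (simp_all add: countable_finite)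
  ultimately show thesis by (intro that[of "\<Union>n. B n"]) auto
qed

text \<open>At each node a large enough next entry catches a given point. Hence each length has a
  bound such that every sequence with an entry at or above it has caught the point somewhere; the
  Menger property selects one bound per length, and these form \<open>q\<close>.\<close>

lemma menger_dominating_branches:
  fixes W :: "nat list \<Rightarrow> nat \<Rightarrow> 'a set"
  assumes "Menger_space X"
    and op: "\<And>s m. openin X (W s m)"
    and mono: "\<And>s. mono (W s)"
    and cov: "\<And>s. (\<Union>m. W s m) = topspace X"
  obtains q :: "nat \<Rightarrow> nat" where
    "\<And>h x. \<lbrakk>\<And>n. q n \<le> h n; x \<in> topspace X\<rbrakk> \<Longrightarrow> \<exists>n. x \<in> W (map h [0..<n]) (h n)"
proof -
  define C where "C n q = {x \<in> topspace X. \<forall>s. length s = n \<and> (\<exists>i<n. q \<le> s ! i) \<longrightarrow>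
    (\<exists>i<n. x \<in> W (take i s) (s ! i))}" for n q
  \<comment> \<open>\<open>C n q\<close> is an infinite intersection and not visibly open; interiors
    make the Menger property applicable.\<close>
  define D where "D n q = X interior_of C n q" for n q
  have D_mono: "mono (D n)" for n
  proof (intro monoI)
    fix q q' :: nat assume "q \<le> q'"
    then have "C n q \<subseteq> C n q'" unfolding C_def by (blast intro: order_trans)
    then show "D n q \<subseteq> D n q'" unfolding D_def by (rule interior_of_mono)
  qed
  \<comment> \<open>Only finitely many sequences of length \<open>n\<close> miss a given point along their whole length.\<close>
  have ex: "\<exists>q. x \<in> D n q" if x: "x \<in> topspace X" for x n
  proof (induction n)
    case 0
    have "D 0 0 = topspace X" by (simp add: C_def D_def)
    then show ?case using x by blast
  next
    case (Suc n)
    then obtain q where q: "x \<in> D n q" ..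
    \<comment> \<open>The induction hypothesis settles every prefix with an entry at least
      \<open>q\<close>. For the finitely many prefixes in \<open>S\<close>, an entry at least
      \<open>q'\<close> can only be the last one, and \<open>q'\<close> is chosen so that this entry
      catches \<open>x\<close> and all points of \<open>N\<close>.\<close>
    define S where "S = {s. set s \<subseteq> {..<q} \<and> length s = n}"
    have fS: "finite S" unfolding S_def by (intro finite_lists_length_eq) simp
    have "\<exists>k. x \<in> W s k" for s using cov[of s] x by blast
    then obtain m where m: "\<And>s. x \<in> W s (m s)" by metis
    define q' where "q' = Max (insert q (m ` S))"
    have q': "q \<le> q'" "\<And>s. s \<in> S \<Longrightarrow> m s \<le> q'"
      using fS by (auto simp: q'_def)
    define N where "N = D n q \<inter> (topspace X \<inter> \<Inter>((\<lambda>s. W s q') ` S))"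
    have "openin X N" unfolding N_def D_def
      using fS op by (intro openin_Int openin_Int_Inter) auto
    moreover have "x \<in> N"
      using q x monoD[OF mono q'(2)] m by (auto simp: N_def)
    moreover have "N \<subseteq> C (Suc n) q'"
    proof
      fix y assume y: "y \<in> N"
      have "\<exists>i<Suc n. y \<in> W (take i s) (s ! i)"
        if s: "length s = Suc n" "i < Suc n" "q' \<le> s ! i" for s i
      proof (cases "take n s \<in> S")
        case True
        have "i = n"
        proof (rule ccontr)
          assume "i \<noteq> n"
          then have "s ! i \<in> set (take n s)"
            using s by (auto simp: in_set_conv_nth intro!: exI[of _ i])
          then show False using True s(3) q'(1) by (force simp: S_def)
        qed
        moreover have "y \<in> W (take n s) q'" using y True by (auto simp: N_def)
        ultimately show ?thesis using s(3) monoD[OF mono] by blast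
      next
        case False
        then obtain j where j: "j < n" "q \<le> take n s ! j"
          using s by (force simp: S_def in_set_conv_nth)
        have "y \<in> C n q" using y interior_of_subset by (fastforce simp: N_def D_def)
        then obtain i where "i < n" "y \<in> W (take i (take n s)) (take n s ! i)"
          using j s unfolding C_def by (auto elim!: allE[of _ "take n s"])
        then show ?thesis by (auto simp: min_def intro!: exI[of _ i])
      qed
      moreover have "y \<in> topspace X" using y by (auto simp: N_def)
      ultimately show "y \<in> C (Suc n) q'" by (auto simp: C_def)
    qed
    ultimately have "x \<in> D (Suc n) q'"
      unfolding D_def using interior_of_maximal by blast
    then show ?case ..
  qed
  have D_cov: "(\<Union>q. D (Suc n) q) = topspace X" for n
    using ex interior_of_subset_topspace[of X] by (fastforce simp: D_def)
  have D_open: "openin X (D n q)" for n q by (simp add: D_def)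
  \<comment> \<open>The shift to \<open>Suc n\<close> lets \<open>q n\<close> be compared with
    \<open>h n\<close>, the last entry of the initial segment of length
    \<open>Suc n\<close>.\<close>
  obtain q where q: "(\<Union>n. D (Suc n) (q n)) = topspace X"
    using menger_monotone_covers[of X "\<lambda>n. D (Suc n)", OF assms(1) D_open D_mono D_cov] .
  show thesis
  proof (rule that[of q])
    fix h x assume h: "\<And>n. q n \<le> h n" and "x \<in> topspace X"
    then obtain n where "x \<in> D (Suc n) (q n)" using q by blast
    then have "x \<in> C (Suc n) (q n)"
      using interior_of_subset[of X] unfolding D_def by blast
    moreover have "q n \<le> map h [0..<Suc n] ! n" using h by (simp del: upt_Suc)
    ultimately obtain i where "i < Suc n"
        "x \<in> W (take i (map h [0..<Suc n])) (map h [0..<Suc n] ! i)"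
      unfolding C_def by (auto elim!: allE[of _ "map h [0..<Suc n]"] simp del: upt_Suc)
    then show "\<exists>n. x \<in> W (map h [0..<n]) (h n)"
      by (auto simp: take_map simp del: upt_Suc intro!: exI[of _ i])
  qed
qed

text \<open>The preceding lemma, applied to the subtree above each finite sequence \<open>t\<close>,
  gives a bound \<open>q t\<close>. If \<open>g\<close> dominates, from each level \<open>k\<close>
  on, the bound of its own initial segment of length \<open>k\<close>, it catches every point at or
  after level \<open>k\<close>.\<close>

lemma menger_branch_infinitely_often:
  fixes W :: "nat list \<Rightarrow> nat \<Rightarrow> 'a set"
  assumes "Menger_space X"
    and op: "\<And>s m. openin X (W s m)"
    and mono: "\<And>s. mono (W s)"
    and cov: "\<And>s. (\<Union>m. W s m) = topspace X"
  obtains g :: "nat \<Rightarrow> nat" where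
    "\<And>x. x \<in> topspace X \<Longrightarrow> \<exists>\<^sub>\<infinity>n. x \<in> W (map g [0..<n]) (g n)"
proof -
  have "\<exists>q. \<forall>h x. (\<forall>n. q n \<le> h n) \<longrightarrow> x \<in> topspace X \<longrightarrow>
      (\<exists>n. x \<in> W (t @ map h [0..<n]) (h n))" for t
    by (rule menger_dominating_branches[of X "\<lambda>s. W (t @ s)"]) (use assms in blast)+
  then obtain q where q: "\<And>t h x. \<lbrakk>\<And>n. q t n \<le> h n; x \<in> topspace X\<rbrakk> \<Longrightarrow>
      \<exists>n. x \<in> W (t @ map h [0..<n]) (h n)"
    by metis
  \<comment> \<open>The sum dominates each of its terms, and the term for \<open>k\<close> reads
    only values of \<open>g\<close> below \<open>k\<close>, so the recursion is well
    founded.\<close>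
  have "\<exists>g::nat \<Rightarrow> nat. \<forall>n. g n = (\<Sum>k\<le>n. q (map g [0..<k]) (n - k))"
    by (rule dependent_wellorder_choice) (auto intro!: sum.cong arg_cong2[of _ _ _ _ q])
  then obtain g :: "nat \<Rightarrow> nat" where
    g: "\<And>n. g n = (\<Sum>k\<le>n. q (map g [0..<k]) (n - k))" by blast
  have dom: "q (map g [0..<k]) n \<le> g (k + n)" for k n
  proof -
    have "q (map g [0..<k]) (k + n - k) \<le> (\<Sum>j\<le>k+n. q (map g [0..<j]) (k + n - j))"
      by (rule member_le_sum) auto
    then show ?thesis using g[of "k + n"] by simp
  qed
  show thesis
  proof (rule that[of g])
    fix x assume x: "x \<in> topspace X"
    show "\<exists>\<^sub>\<infinity>n. x \<in> W (map g [0..<n]) (g n)"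
      unfolding INFM_nat_le
    proof
      fix k
      obtain n where n: "x \<in> W (map g [0..<k] @ map (\<lambda>i. g (k + i)) [0..<n]) (g (k + n))"
        using q[of "map g [0..<k]" "\<lambda>i. g (k + i)", OF dom x] by blast
      have "map g [0..<k] @ map (\<lambda>i. g (k + i)) [0..<n] = map g [0..<k + n]"
        by (rule nth_equalityI) (auto simp: nth_append)
      with n show "\<exists>n\<ge>k. x \<in> W (map g [0..<n]) (g n)"
        by (auto intro!: exI[of _ "k + n"])
    qed
  qed
qed

section \<open>Selections in almost Rothberger spaces\<close>

text \<open>Greedy choice: at most \<open>n\<close> earlier values cannot exhaust a set with more
  than \<open>n\<close> elements.\<close>

lemma injective_choice:
  fixes K :: "nat \<Rightarrow> 'b set"
  assumes "\<And>n. finite (K n)" "\<And>n. n < card (K n)"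
  obtains k where "inj k" "\<And>n. k n \<in> K n"
proof -
  have "\<exists>k. \<forall>n. k n \<in> K n - k ` {..<n}"
  proof (rule dependent_wellorder_choice)
    fix n and k :: "nat \<Rightarrow> 'b"
    have "card (k ` {..<n}) < card (K n)"
      using card_image_le[of "{..<n}" k] assms(2)[of n] by simp
    then have "\<not> K n \<subseteq> k ` {..<n}" using card_mono[of "k ` {..<n}" "K n"] by auto
    then show "\<exists>r. r \<in> K n - k ` {..<n}" by blast
  qed auto
  then obtain k where k: "\<And>n. k n \<in> K n - k ` {..<n}" by blast
  have "inj k"
  proof (rule linorder_injI)
    fix m n :: nat assume "m < n"
    then show "k m \<noteq> k n" using k[of n] by (metis DiffD2 imageI lessThan_iff)
  qed
  with k that show thesis by blast
qed

text \<open>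
  Selecting from the cover by intersections of \<open>n + 1\<close> sets with distinct indices leaves, at
  step \<open>n\<close>, an index that has not been used before.
\<close>

lemma almost_Rothberger_infinitely_often:
  fixes U :: "nat \<Rightarrow> 'i \<Rightarrow> 'a set"
  assumes "almost_Rothberger_space X"
    and op: "\<And>n i. i \<in> I n \<Longrightarrow> openin X (U n i)"
    and ne: "\<And>n. I n \<noteq> {}"
    and inf: "\<And>x. x \<in> topspace X \<Longrightarrow> \<exists>\<^sub>\<infinity>n. x \<in> (\<Union>i\<in>I n. U n i)"
  obtains c where "\<forall>n. c n \<in> I n" "topspace X \<subseteq> (\<Union>n. X closure_of U n (c n))"
proof -
  define V where "V n = {topspace X \<inter> (\<Inter>k\<in>K. U k (d k)) |K d.
      finite K \<and> card K = Suc n \<and> (\<forall>k\<in>K. d k \<in> I k)}" for n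
  have "V n \<in> open_covers X" for n
  proof -
    have "openin X A" if "A \<in> V n" for A
      using that op unfolding V_def by (auto intro!: openin_Int_Inter)
    moreover have "\<exists>A\<in>V n. x \<in> A" if x: "x \<in> topspace X" for x
    proof -
      obtain K where K: "finite K" "card K = Suc n" "K \<subseteq> {k. x \<in> (\<Union>i\<in>I k. U k i)}"
        using infinite_arbitrarily_large inf[OF x] unfolding INFM_iff_infinite by blast
      then have "\<forall>k\<in>K. \<exists>i. i \<in> I k \<and> x \<in> U k i" by blast
      then obtain d where "\<forall>k\<in>K. d k \<in> I k \<and> x \<in> U k (d k)" by metis
      then have "topspace X \<inter> (\<Inter>k\<in>K. U k (d k)) \<in> V n" "x \<in> topspace X \<inter> (\<Inter>k\<in>K. U k (d k))"
        using K x unfolding V_def by blast+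
      then show ?thesis by blast
    qed
    ultimately show ?thesis
      unfolding open_covers_def by (auto dest: openin_subset)
  qed
  then obtain B where B: "\<And>n. B n \<in> V n" and Bc: "{B n |n. True} \<in> almost_open_covers X"
    using assms(1) unfolding almost_Rothberger_space_def S1_def
    by (elim allE[of _ V]) auto
  from B have "\<forall>n. \<exists>K d. B n = topspace X \<inter> (\<Inter>k\<in>K. U k (d k)) \<and>
      finite K \<and> card K = Suc n \<and> (\<forall>k\<in>K. d k \<in> I k)"
    unfolding V_def by blast
  then obtain K d where Kd: "\<And>n. B n = topspace X \<inter> (\<Inter>k\<in>K n. U k (d n k))"
      "\<And>n. finite (K n)" "\<And>n. card (K n) = Suc n" "\<And>n k. k \<in> K n \<Longrightarrow> d n k \<in> I k"
    by metis
  obtain k where k: "inj k" "\<And>n. k n \<in> K n"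
    using injective_choice[of K] Kd(2,3) by (metis lessI)
  \<comment> \<open>Since \<open>k\<close> is injective, at most one step claims the index
    \<open>n\<close>, and \<open>c n\<close> is what that step chose there; unclaimed indices get an
    arbitrary element of \<open>I n\<close>.\<close>
  define c where "c n = (if n \<in> range k then d (inv k n) n else (SOME i. i \<in> I n))" for n
  show thesis
  proof (rule that[of c])
    show "\<forall>n. c n \<in> I n"
      using k Kd(4) ne by (auto simp: c_def some_in_eq)
  next
    show "topspace X \<subseteq> (\<Union>n. X closure_of U n (c n))"
    proof
      fix x assume "x \<in> topspace X"
      then obtain n where "x \<in> X closure_of B n"
        using Bc unfolding almost_open_covers_def by blast
      moreover have "B n \<subseteq> U (k n) (c (k n))"
        using k by (auto simp: Kd(1) c_def)
      ultimately show "x \<in> (\<Union>n. X closure_of U n (c n))"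
        using closure_of_mono by blast
    qed
  qed
qed

text \<open>The branch \<open>f\<close> is known only after all selections are made, so the
  selection at level \<open>n\<close> must answer every position that could occur. The bound
  \<open>g\<close> leaves finitely many of these, which keeps the intersections open.\<close>

lemma almost_covering_branch:
  fixes U :: "nat list \<Rightarrow> nat \<Rightarrow> 'a set"
  assumes "Menger_space X" "almost_Rothberger_space X"
    and op: "\<And>s k. openin X (U s k)"
    and cov: "\<And>s. (\<Union>k. U s k) = topspace X"
  obtains f where "topspace X \<subseteq> (\<Union>n. X closure_of U (map f [0..<n]) (f n))"
proof -
  define B :: "nat list \<Rightarrow> nat list set" where "B s = {t. list_all2 (\<le>) t s}" for s
  have fB: "finite (B s)" for s
  proof (rule finite_subset)
    show "B s \<subseteq> {t. set t \<subseteq> {..Max (insert 0 (set s))} \<and> length t = length s}"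
    proof
      fix t assume "t \<in> B s"
      then have t: "length t = length s" "\<And>i. i < length s \<Longrightarrow> t ! i \<le> s ! i"
        by (auto simp: B_def list_all2_conv_all_nth)
      have "t ! i \<le> Max (insert 0 (set s))" if "i < length s" for i
        using t(2)[OF that] that by (meson Max_ge finite_insert finite_set insertI2 le_trans nth_mem)
      with t(1) show "t \<in> {t. set t \<subseteq> {..Max (insert 0 (set s))} \<and> length t = length s}"
        by (auto simp: in_set_conv_nth simp del: Max_insert)
    qed
  qed (intro finite_lists_length_eq, simp)
  define W where "W s m = topspace X \<inter> (\<Inter>t\<in>B s. \<Union>k\<le>m. U t k)" for s m
  have "openin X (W s m)" for s m
    unfolding W_def using fB op by (intro openin_Int_Inter) auto
  moreover have "mono (W s)" for s
    unfolding W_def by (intro monoI) (blast intro: order_trans)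
  moreover have "(\<Union>m. W s m) = topspace X" for s
  proof -
    have "\<exists>m. x \<in> W s m" if x: "x \<in> topspace X" for x
    proof -
      have "\<exists>k. x \<in> U t k" for t using cov[of t] x by blast
      then obtain k where k: "\<And>t. x \<in> U t (k t)" by metis
      have "x \<in> W s (Max (k ` B s))" using k x fB by (fastforce simp: W_def)
      then show ?thesis ..
    qed
    then show ?thesis by (auto simp: W_def)
  qed
  ultimately obtain g where g: "\<And>x. x \<in> topspace X \<Longrightarrow> \<exists>\<^sub>\<infinity>n. x \<in> W (map g [0..<n]) (g n)"
    using menger_branch_infinitely_often[OF assms(1)] by blast
  \<comment> \<open>An element of \<open>I n\<close> answers all positions at once, with indices at
    most \<open>g n\<close>; this later keeps the branch below \<open>g\<close>.\<close>
  define I where "I n = {p :: nat list \<Rightarrow> nat. \<forall>t. p t \<le> g n}" for n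
  define A where "A n p = topspace X \<inter> (\<Inter>t\<in>B (map g [0..<n]). U t (p t))" for n p
  have WA: "W (map g [0..<n]) (g n) \<subseteq> (\<Union>p\<in>I n. A n p)" for n
  proof
    fix x assume x: "x \<in> W (map g [0..<n]) (g n)"
    then have "\<forall>t. \<exists>k\<le>g n. t \<in> B (map g [0..<n]) \<longrightarrow> x \<in> U t k"
      unfolding W_def by blast
    then obtain p where "\<And>t. p t \<le> g n" "\<And>t. t \<in> B (map g [0..<n]) \<Longrightarrow> x \<in> U t (p t)"
      by metis
    with x show "x \<in> (\<Union>p\<in>I n. A n p)" by (auto simp: I_def A_def W_def)
  qed
  have A_open: "openin X (A n p)" for n p
    unfolding A_def using fB op by (intro openin_Int_Inter) auto
  have I_ne: "I n \<noteq> {}" for n by (auto simp: I_def)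
  have A_inf: "\<exists>\<^sub>\<infinity>n. x \<in> (\<Union>p\<in>I n. A n p)" if "x \<in> topspace X" for x
    using g[OF that] by (rule INFM_mono) (use WA in blast)
  obtain p where p: "\<forall>n. p n \<in> I n"
      and pc: "topspace X \<subseteq> (\<Union>n. X closure_of A n (p n))"
    using almost_Rothberger_infinitely_often[OF assms(2), of I A, OF A_open I_ne A_inf] .
  \<comment> \<open>Following the selected answers traces out a branch; as it stays below
    \<open>g\<close>, its positions are among those intersected over in \<open>A\<close>.\<close>
  have "\<exists>f. \<forall>n. f n = p n (map f [0..<n])"
    by (rule dependent_wellorder_choice) (auto intro!: arg_cong[of _ _ "p _"])
  then obtain f where f: "\<And>n. f n = p n (map f [0..<n])" by blast
  have "f n \<le> g n" for n using p by (subst f) (simp add: I_def)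
  then have "map f [0..<n] \<in> B (map g [0..<n])" for n
    by (simp add: B_def list_all2_conv_all_nth)
  then have "A n (p n) \<subseteq> U (map f [0..<n]) (f n)" for n
    by (subst f) (auto simp: A_def)
  then have "X closure_of A n (p n) \<subseteq> X closure_of U (map f [0..<n]) (f n)" for n
    by (rule closure_of_mono)
  with pc show thesis by (intro that[of f]) blast
qed

section \<open>The game and the equivalence\<close>

text \<open>A sequence of covers is a strategy that looks only at the number of the inning; TWO's
  moves in a play that defeats it form the selection.\<close>

lemma almost_Rothberger_if_no_winning_strategy:
  assumes "\<not> (\<exists>\<sigma>. G1_winning_strategy_ONE (open_covers X) (almost_open_covers X) \<sigma>)"
  shows "almost_Rothberger_space X"
  unfolding almost_Rothberger_space_def S1_def
proof (intro allI impI)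
  fix A :: "nat \<Rightarrow> 'a set set" assume A: "\<forall>n. A n \<in> open_covers X"
  have "G1_strategy_ONE (open_covers X) (\<lambda>ts. A (length ts))"
    using A by (simp add: G1_strategy_ONE_def)
  with assms obtain C T where "G1_play (open_covers X) C T"
      "G1_follows_ONE (\<lambda>ts. A (length ts)) C T" "G1_TWO_wins (almost_open_covers X) T"
    unfolding G1_winning_strategy_ONE_def by blast
  then show "\<exists>B. (\<forall>n. B n \<in> A n) \<and> {B n |n. True} \<in> almost_open_covers X"
    by (intro exI[of _ T]) (simp add: G1_play_def G1_follows_ONE_def G1_TWO_wins_def)
qed

text \<open>Coding TWO's replies by indices into countable subcovers turns the strategy into a tree
  of covers; a branch whose closures cover is a play won by TWO.\<close>

lemma almost_Rothberger_beats_strategy: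
  assumes "topspace X \<noteq> {}" "Menger_space X" "almost_Rothberger_space X"
    and strat: "G1_strategy_ONE (open_covers X) \<sigma>"
  shows "\<exists>C T. G1_play (open_covers X) C T \<and> G1_follows_ONE \<sigma> C T \<and>
    G1_TWO_wins (almost_open_covers X) T"
proof -
  have "\<exists>e :: nat \<Rightarrow> 'a set. \<U> \<in> open_covers X \<longrightarrow> range e \<subseteq> \<U> \<and> (\<Union>k. e k) = topspace X" for \<U>
  proof (cases "\<U> \<in> open_covers X")
    case True
    obtain \<V> where V: "countable \<V>" "\<V> \<subseteq> \<U>" "\<V> \<in> open_covers X"
      using menger_countable_subcover[OF assms(2) True] .
    \<comment> \<open>Nonemptiness allows an enumeration by all natural numbers, possibly with
      repetitions.\<close>
    have "\<V> \<noteq> {}"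
    proof
      assume "\<V> = {}"
      then have "topspace X = {}" using V(3) by (simp add: open_covers_def)
      with assms(1) show False ..
    qed
    then have "range (from_nat_into \<V>) = \<V>" using V(1) by simp
    then show ?thesis using V by (intro exI[of _ "from_nat_into \<V>"]) (auto simp: open_covers_def)
  qed auto
  then obtain e :: "'a set set \<Rightarrow> nat \<Rightarrow> 'a set" where
    e: "\<And>\<U>. \<U> \<in> open_covers X \<Longrightarrow> range (e \<U>) \<subseteq> \<U> \<and> (\<Union>k. e \<U> k) = topspace X"
    by metis
  \<comment> \<open>\<open>pos s\<close> decodes an index sequence into the list of TWO's
    moves.\<close>
  define pos where "pos = foldl (\<lambda>ts k. ts @ [e (\<sigma> ts) k]) []"
  have pos_simps: "pos [] = []" "pos (s @ [k]) = pos s @ [e (\<sigma> (pos s)) k]" for s k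
    by (simp_all add: pos_def)
  \<comment> \<open>The strategy is guaranteed to yield covers only after legal moves, so legality
    of the decoded lists comes first.\<close>
  have legal: "\<forall>i<length (pos s). pos s ! i \<in> \<sigma> (take i (pos s))" for s
  proof (induction s rule: rev_induct)
    case Nil
    then show ?case by (simp add: pos_simps)
  next
    case (snoc k s)
    then have "\<sigma> (pos s) \<in> open_covers X" using strat by (simp add: G1_strategy_ONE_def)
    then have "e (\<sigma> (pos s)) k \<in> \<sigma> (pos s)" using e by blast
    with snoc show ?case by (auto simp: pos_simps nth_append less_Suc_eq)
  qed
  then have oc: "\<sigma> (pos s) \<in> open_covers X" for s
    using strat by (simp add: G1_strategy_ONE_def)
  define U where "U s = e (\<sigma> (pos s))" for s
  have U: "U s k \<in> \<sigma> (pos s)" "(\<Union>k. U s k) = topspace X" for s k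
    using e[OF oc[of s]] by (auto simp: U_def)
  have Uop: "openin X (U s k)" for s k
    using U(1) oc by (auto simp: open_covers_def)
  obtain f where f: "topspace X \<subseteq> (\<Union>n. X closure_of U (map f [0..<n]) (f n))"
    using almost_covering_branch[OF assms(2,3), of U, OF Uop U(2)] .
  define T where "T n = U (map f [0..<n]) (f n)" for n
  define C where "C n = \<sigma> (map T [0..<n])" for n
  have posT: "pos (map f [0..<n]) = map T [0..<n]" for n
    by (induction n) (simp_all add: pos_simps T_def U_def)
  have "G1_play (open_covers X) C T"
    using oc U(1) by (simp add: G1_play_def C_def T_def flip: posT)
  moreover have "G1_follows_ONE \<sigma> C T" by (simp add: G1_follows_ONE_def C_def)
  moreover have "{T n |n. True} \<in> almost_open_covers X"
    unfolding almost_open_covers_def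
  proof (intro CollectI conjI)
    show "\<forall>V\<in>{T n |n. True}. openin X V" using Uop by (auto simp: T_def)
    have "(\<Union>V\<in>{T n |n. True}. X closure_of V) = (\<Union>n. X closure_of T n)" by blast
    then show "(\<Union>V\<in>{T n |n. True}. X closure_of V) = topspace X"
      using f closure_of_subset_topspace[of X] unfolding T_def by (intro equalityI) auto
  qed
  ultimately show ?thesis unfolding G1_TWO_wins_def by blast
qed

theorem theorem17:
  fixes X :: "'a topology"
  assumes "infinite (topspace X)"
    and "t1_space X"
    and "Menger_space X"
  shows "almost_Rothberger_space X \<longleftrightarrow>
    \<not> (\<exists>\<sigma>. G1_winning_strategy_ONE (open_covers X) (almost_open_covers X) \<sigma>)"
proof
  assume "almost_Rothberger_space X"
  moreover have "topspace X \<noteq> {}" using assms(1) by auto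
  ultimately show "\<not> (\<exists>\<sigma>. G1_winning_strategy_ONE (open_covers X) (almost_open_covers X) \<sigma>)"
    using almost_Rothberger_beats_strategy[OF _ assms(3)]
    unfolding G1_winning_strategy_ONE_def by blast
qed (rule almost_Rothberger_if_no_winning_strategy)

end
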